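(* Let $p\in(1,\infty)$, $p^*=p/(p-1)$, and $\eta>0$. Let $A\subset\mathbb{R}^q$ be a compact convex set with $\operatorname{int}A\ne\emptyset$ and let $P_k\supseteq A$ be a polyhedral outer approximation of $A$ generated at iteration $k$ by the norm-minimization algorithm with $\|\cdot\|_p$ scalarization (described in the context). Let $v,v'\notin A$ be vertices of $P_k$, let $y=\arg\min_{u\in A}\|u-v\|_p$ and $y'=\arg\min_{u\in A}\|u-v'\|_p$ be the corresponding support points in $\operatorname{bd}A$, let $z=y-v$, $z'=y'-v'$, and let $w=\nabla\|z\|_p$, $w'=\nabla\|z'\|_p$ be the associated cut normals, which satisfy $\|w\|_{p^*}=\|w'\|_{p^*}=1$. Let $\alpha=y-\eta w$ and $\alpha'=y'-\eta w'$. Then the hyperplane distance $d:=\langle w',y-y'\rangle$ satisfies $d\ge0$ and $$d\le C(p,q)\,\frac{\|\alpha-\alpha'\|_p^2}{\eta},\qquad C(p,q):=\begin{cases}q^{1-2/p}/2&\text{if }p\ge2,\\ 1/2&\text{if }1<p\le2.\end{cases}$$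
   Context: $\|\cdot\|_p$ is the $\ell_p$ norm on $\mathbb{R}^q$, $\langle\cdot,\cdot\rangle$ is the Euclidean inner product, and $\nabla\|z\|_p$ denotes the gradient of $\|\cdot\|_p$ at $z\neq0$, i.e. the vector with components $|z_i|^{p-1}\operatorname{sgn}(z_i)/\|z\|_p^{p-1}$. Norm-minimization algorithm with $\|\cdot\|_p$ scalarization: $P_0\supseteq A$ is a polytope that is the intersection of finitely many supporting halfspaces of $A$. Given a polytope $P_k\supseteq A$ with vertex set $\operatorname{ext}(P_k)$, for each $v\in\operatorname{ext}(P_k)$ let $y^v:=\arg\min_{y\in A}\|y-v\|_p$ (unique) and $z^v:=y^v-v$. Choose $v^k\in\operatorname{ext}(P_k)$ maximizing $\|z^v\|_p$; if $z^{v^k}\ne0$, let $w^k:=\nabla\|z^{v^k}\|_p$ and set $P_{k+1}:=P_k\cap\{y\in\mathbb{R}^q:\langle w^k,y\rangle\ge\langle w^k,y^{v^k}\rangle\}$, the last set being a halfspace that contains $A$ and supports it at $y^{v^k}$. *)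

theory Defs
  imports "HOL-Analysis.Analysis"
begin

definition lp_norm :: "real \<Rightarrow> real ^ 'n \<Rightarrow> real"
  where "lp_norm p x = (\<Sum>i\<in>UNIV. \<bar>x $ i\<bar> powr p) powr (1 / p)"

definition lp_grad :: "real \<Rightarrow> real ^ 'n \<Rightarrow> real ^ 'n"
  where "lp_grad p z = (\<chi> i. \<bar>z $ i\<bar> powr (p - 1) * sgn (z $ i) / lp_norm p z powr (p - 1))"

lemma has_real_derivative_abs:
  fixes t :: real
  assumes "t \<noteq> 0"
  shows "(abs has_real_derivative sgn t) (at t)"
proof (cases "t > 0")
  case True
  have "((\<lambda>t. t) has_real_derivative sgn t) (at t)" using True by simp
  then show ?thesis
    by (rule has_field_derivative_transform_within_open[of _ _ _ "{0<..}"]) (use True in auto)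
next
  case False
  have "((\<lambda>t. - t) has_real_derivative sgn t) (at t)"
    using False assms by (auto intro!: derivative_eq_intros)
  then show ?thesis
    by (rule has_field_derivative_transform_within_open[of _ _ _ "{..<0}"]) (use False assms in auto)
qed

lemma has_derivative_abs_powr:
  fixes t p :: real
  assumes "p > 1"
  shows "((\<lambda>t. \<bar>t\<bar> powr p) has_real_derivative p * (\<bar>t\<bar> powr (p - 1) * sgn t)) (at t)"
proof (cases "t = 0")
  case True
  have "((\<lambda>h::real. \<bar>h\<bar> powr (p - 1)) \<longlongrightarrow> 0) (at 0)"
    using assms by (intro tendsto_eq_intros | simp)+
  then have "((\<lambda>h::real. \<bar>h\<bar> powr p / h) \<longlongrightarrow> 0) (at 0)"
    by (rule Lim_null_comparison[rotated])
       (auto simp: eventually_at powr_diff intro!: exI[of _ 1])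
  then show ?thesis
    using True assms by (simp add: DERIV_def)
next
  case False
  have "((\<lambda>t. \<bar>t\<bar> powr p) has_real_derivative p * \<bar>t\<bar> powr (p - 1) * sgn t) (at t)"
    using False has_real_derivative_abs[OF False]
    by (auto intro!: derivative_eq_intros simp: powr_diff)
  then show ?thesis by (simp add: mult.assoc)
qed

text \<open>For \<open>z \<noteq> 0\<close>, \<^const>\<open>lp_grad\<close> is the gradient of \<^const>\<open>lp_norm\<close>.\<close>

lemma lp_norm_has_derivative:
  fixes z :: "real ^ 'n"
  assumes "p > 1" and "z \<noteq> 0"
  shows "(lp_norm p has_derivative (\<lambda>h. lp_grad p z \<bullet> h)) (at z)"
proof -
  define S where "S x = (\<Sum>i\<in>UNIV. \<bar>x $ i\<bar> powr p)" for x :: "real ^ 'n"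
  obtain j where "z $ j \<noteq> 0" using assms(2) by (auto simp: vec_eq_iff)
  then have S0: "S z > 0" unfolding S_def
    by (intro sum_pos2[of _ j]) auto
  have c: "((\<lambda>x. \<bar>x $ i\<bar> powr p) has_derivative
      (\<lambda>h. p * (\<bar>z $ i\<bar> powr (p - 1) * sgn (z $ i)) * (h $ i))) (at z)" for i
    by (rule DERIV_compose_FDERIV[OF has_derivative_abs_powr[OF assms(1)], where g="\<lambda>x. x $ i", THEN has_derivative_eq_rhs])
       (auto intro!: bounded_linear.has_derivative[OF bounded_linear_vec_nth] has_derivative_ident simp: fun_eq_iff)
  have dS: "(S has_derivative (\<lambda>h. \<Sum>i\<in>UNIV. p * (\<bar>z $ i\<bar> powr (p - 1) * sgn (z $ i)) * (h $ i))) (at z)"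
    unfolding S_def by (intro has_derivative_sum c)
  have dp: "((\<lambda>s. s powr (1 / p)) has_real_derivative (1 / p) * S z powr (1 / p - 1)) (at (S z))"
    using S0 by (rule has_real_derivative_powr)
  have N: "lp_norm p = (\<lambda>x. S x powr (1 / p))"
    by (auto simp: lp_norm_def S_def)
  have e: "S z powr (1 / p - 1) = 1 / lp_norm p z powr (p - 1)"
  proof -
    have "1 / p - 1 = - ((p - 1) / p)" using assms(1) by (simp add: field_simps)
    then show ?thesis using S0 unfolding N
      by (simp only: powr_minus_divide powr_powr times_divide_eq_left mult_1)
  qed
  have "(\<Sum>i\<in>UNIV. p * (\<bar>z $ i\<bar> powr (p - 1) * sgn (z $ i)) * (h $ i)) * ((1 / p) * S z powr (1 / p - 1))
      = lp_grad p z \<bullet> h" for h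
    unfolding e lp_grad_def inner_vec_def sum_distrib_right
    using assms(1) by (intro sum.cong) (auto simp: field_simps)
  then show ?thesis
    using DERIV_compose_FDERIV[OF dp dS] unfolding N by (simp add: mult.commute)
qed

definition lp_nearest :: "real \<Rightarrow> (real ^ 'n) set \<Rightarrow> real ^ 'n \<Rightarrow> real ^ 'n \<Rightarrow> bool"
  where "lp_nearest p A v y \<longleftrightarrow> is_arg_min (\<lambda>u. lp_norm p (u - v)) (\<lambda>u. u \<in> A) y"

definition supporting_halfspace :: "(real ^ 'n) set \<Rightarrow> (real ^ 'n) set \<Rightarrow> bool"
  where "supporting_halfspace A H \<longleftrightarrow>
    (\<exists>a b. a \<noteq> 0 \<and> H = {y. a \<bullet> y \<ge> b} \<and> A \<subseteq> H \<and> (\<exists>x\<in>A. a \<bullet> x = b))"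

definition initial_outer_approx :: "(real ^ 'n) set \<Rightarrow> (real ^ 'n) set \<Rightarrow> bool"
  where "initial_outer_approx A P \<longleftrightarrow>
    polytope P \<and> A \<subseteq> P \<and>
    (\<exists>F. finite F \<and> (\<forall>H\<in>F. supporting_halfspace A H) \<and> P = \<Inter>F)"

text \<open>There is no step out of \<open>P\<close> when the selected vertex already lies in \<open>A\<close>.\<close>

definition norm_min_step :: "real \<Rightarrow> (real ^ 'n) set \<Rightarrow> (real ^ 'n) set \<Rightarrow> (real ^ 'n) set \<Rightarrow> bool"
  where "norm_min_step p A P P' \<longleftrightarrow>
    (\<exists>v y. v extreme_point_of P \<and> lp_nearest p A v y \<and>
      (\<forall>v' y'. v' extreme_point_of P \<and> lp_nearest p A v' y' \<longrightarrow>
        lp_norm p (y' - v') \<le> lp_norm p (y - v)) \<and>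
      y - v \<noteq> 0 \<and>
      P' = P \<inter> {u. lp_grad p (y - v) \<bullet> u \<ge> lp_grad p (y - v) \<bullet> y})"

definition norm_min_run :: "real \<Rightarrow> (real ^ 'n) set \<Rightarrow> (nat \<Rightarrow> (real ^ 'n) set) \<Rightarrow> nat \<Rightarrow> bool"
  where "norm_min_run p A P k \<longleftrightarrow>
    initial_outer_approx A (P 0) \<and> (\<forall>i<k. norm_min_step p A (P i) (P (Suc i)))"

definition lp_const :: "real \<Rightarrow> nat \<Rightarrow> real"
  where "lp_const p q = (if p \<ge> 2 then real q powr (1 - 2 / p) / 2 else 1 / 2)"

end

theory Submission
  imports Defs
begin

text \<open>
  Write \<open>\<Delta> = y - y'\<close> and \<open>\<delta> = w - w'\<close>, so that \<open>\<alpha> - \<alpha>' = \<Delta> - \<eta> \<delta>\<close>. First-order optimality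
  of the nearest points says that the hyperplane through \<open>y\<close> with normal \<open>w\<close> supports the convex
  set \<open>A\<close>, and likewise for \<open>y'\<close> and \<open>w'\<close>. Hence \<open>\<langle>w', \<Delta>\<rangle> \<ge> 0\<close> and \<open>\<langle>w, \<Delta>\<rangle> \<le> 0\<close>: the cut normal is
  antitone in the support point, \<open>\<langle>\<delta>, \<Delta>\<rangle> \<le> -\<langle>w', \<Delta>\<rangle>\<close>. Expanding the Euclidean
  square gives \<open>\<parallel>\<Delta> - \<eta> \<delta>\<parallel>\<^sub>2\<^sup>2 \<ge> - 2 \<eta> \<langle>\<delta>, \<Delta>\<rangle> \<ge> 2 \<eta> d\<close>.
  To return to \<open>\<parallel>\<cdot>\<parallel>\<^sub>p\<close>, use the comparison
  \<open>\<parallel>x\<parallel>\<^sub>2\<^sup>2 \<le> 2 C(p,q) \<parallel>x\<parallel>\<^sub>p\<^sup>2\<close> of \<open>norm_sq_le_lp_norm_sq\<close>, which is Jensen's inequality for \<open>p \<ge> 2\<close> and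
  monotonicity of the \<open>\<ell>\<^sub>p\<close> norms in \<open>p\<close> for \<open>p \<le> 2\<close>.
\<close>

lemma lp_norm_pos:
  fixes x :: "real ^ 'n"
  assumes "x \<noteq> 0"
  shows "lp_norm p x > 0"
proof -
  obtain j where "x $ j \<noteq> 0" using assms by (auto simp: vec_eq_iff)
  then have "(\<Sum>i\<in>UNIV. \<bar>x $ i\<bar> powr p) > 0"
    by (intro sum_pos2[of _ j]) auto
  then show ?thesis by (simp add: lp_norm_def)
qed

lemma lp_norm_scaleR:
  fixes x :: "real ^ 'n"
  assumes "p > 1" and "c \<ge> 0"
  shows "lp_norm p (c *\<^sub>R x) = c * lp_norm p x"
proof -
  have "(\<Sum>i\<in>UNIV. \<bar>(c *\<^sub>R x) $ i\<bar> powr p) = c powr p * (\<Sum>i\<in>UNIV. \<bar>x $ i\<bar> powr p)"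
    using assms by (simp add: abs_mult powr_mult sum_distrib_left)
  then show ?thesis
    using assms by (simp add: lp_norm_def powr_mult powr_powr sum_nonneg)
qed

lemma lp_norm_powr:
  fixes x :: "real ^ 'n"
  assumes "p > 1"
  shows "lp_norm p x powr p = (\<Sum>i\<in>UNIV. \<bar>x $ i\<bar> powr p)"
  using assms by (simp add: lp_norm_def powr_powr sum_nonneg)

lemma lp_norm_lp_grad:
  fixes z :: "real ^ 'n"
  assumes "p > 1" and "z \<noteq> 0"
  shows "lp_norm (p / (p - 1)) (lp_grad p z) = 1"
proof -
  have N: "lp_norm p z > 0" using assms(2) by (rule lp_norm_pos)
  have "\<bar>lp_grad p z $ i\<bar> powr (p / (p - 1)) = \<bar>z $ i\<bar> powr p / lp_norm p z powr p" for i
    using assms(1) N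
    by (cases "z $ i = 0") (simp_all add: lp_grad_def abs_mult abs_sgn_eq powr_divide powr_powr)
  then have "(\<Sum>i\<in>UNIV. \<bar>lp_grad p z $ i\<bar> powr (p / (p - 1)))
      = (\<Sum>i\<in>UNIV. \<bar>z $ i\<bar> powr p) / lp_norm p z powr p"
    by (simp add: sum_divide_distrib)
  also have "\<dots> = 1" using N by (simp flip: lp_norm_powr[OF assms(1)])
  finally show ?thesis by (simp add: lp_norm_def)
qed

text \<open>If \<open>y\<close> were interior, moving it a little towards \<open>v\<close> would stay in \<open>A\<close> and shrink the
  distance by homogeneity.\<close>

lemma lp_nearest_in_frontier:
  fixes A :: "(real ^ 'n) set"
  assumes "p > 1" and near: "lp_nearest p A v y" and "v \<notin> A"
  shows "y \<in> frontier A"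
proof -
  have yA: "y \<in> A" and min: "\<And>u. u \<in> A \<Longrightarrow> lp_norm p (y - v) \<le> lp_norm p (u - v)"
    using near by (auto simp: lp_nearest_def is_arg_min_linorder)
  have N: "lp_norm p (y - v) > 0"
    using yA \<open>v \<notin> A\<close> by (intro lp_norm_pos) auto
  have "y \<notin> interior A"
  proof
    assume "y \<in> interior A"
    then obtain e where e: "e > 0" "ball y e \<subseteq> A" by (auto simp: mem_interior)
    have yv: "norm (y - v) > 0" using yA \<open>v \<notin> A\<close> by auto
    define t where "t = min 1 (e / (2 * norm (y - v)))"
    have t: "0 < t" "t \<le> 1" using e yv by (auto simp: t_def)
    have "t * norm (y - v) \<le> e / (2 * norm (y - v)) * norm (y - v)"
      by (intro mult_right_mono) (auto simp: t_def)
    also have "\<dots> < e" using e yv by simp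
    finally have "y - t *\<^sub>R (y - v) \<in> ball y e" using t by (simp add: dist_norm)
    then have "y - t *\<^sub>R (y - v) \<in> A" using e by blast
    then have "lp_norm p (y - v) \<le> lp_norm p (y - t *\<^sub>R (y - v) - v)" by (rule min)
    also have "y - t *\<^sub>R (y - v) - v = (1 - t) *\<^sub>R (y - v)" by (simp add: algebra_simps)
    also have "lp_norm p \<dots> = (1 - t) * lp_norm p (y - v)"
      using assms(1) t by (simp add: lp_norm_scaleR)
    finally have "t * lp_norm p (y - v) \<le> 0" by (simp add: algebra_simps)
    then show False using N t by (simp add: mult_le_0_iff)
  qed
  then show ?thesis using yA closure_subset by (auto simp: frontier_def)
qed

text \<open>First-order optimality: along the segment from \<open>y\<close> to \<open>u\<close>, which lies in \<open>A\<close>, the distance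
  to \<open>v\<close> cannot start to decrease, and its initial slope is the inner product below.\<close>

lemma lp_nearest_supporting:
  fixes A :: "(real ^ 'n) set"
  assumes "p > 1" and "convex A" and near: "lp_nearest p A v y" and "v \<notin> A" and "u \<in> A"
  shows "lp_grad p (y - v) \<bullet> (u - y) \<ge> 0"
proof (rule ccontr)
  have yA: "y \<in> A" and min: "\<And>u. u \<in> A \<Longrightarrow> lp_norm p (y - v) \<le> lp_norm p (u - v)"
    using near by (auto simp: lp_nearest_def is_arg_min_linorder)
  have nz: "y - v \<noteq> 0" using yA \<open>v \<notin> A\<close> by auto
  define g where "g t = lp_norm p (y - v + t *\<^sub>R (u - y))" for t :: real
  assume neg: "\<not> lp_grad p (y - v) \<bullet> (u - y) \<ge> 0"
  have "((\<lambda>t. y - v + t *\<^sub>R (u - y)) has_derivative (\<lambda>t. t *\<^sub>R (u - y))) (at 0)"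
    by (auto intro!: derivative_eq_intros)
  from has_derivative_compose[OF this, of "lp_norm p" "\<lambda>h. lp_grad p (y - v) \<bullet> h"]
  have "(g has_derivative (\<lambda>t. lp_grad p (y - v) \<bullet> (t *\<^sub>R (u - y)))) (at 0)"
    using lp_norm_has_derivative[OF assms(1) nz] by (simp add: g_def[abs_def])
  then have "DERIV g 0 :> lp_grad p (y - v) \<bullet> (u - y)"
    by (simp add: has_field_derivative_def mult.commute[of _ "lp_grad p (y - v) \<bullet> (u - y)"] mult_commute_abs)
  from DERIV_neg_dec_right[OF this] neg
  obtain d where d: "d > 0" "\<And>h. h > 0 \<Longrightarrow> h < d \<Longrightarrow> g h < g 0" by auto
  define h where "h = min 1 (d / 2)"
  have h: "0 < h" "h < d" "h \<le> 1" using d by (auto simp: h_def)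
  have "(1 - h) *\<^sub>R y + h *\<^sub>R u \<in> A"
    using \<open>convex A\<close> yA \<open>u \<in> A\<close> h by (intro convexD) auto
  from min[OF this] have "g 0 \<le> g h"
    by (simp add: g_def algebra_simps)
  then show False using d(2)[OF h(1,2)] by simp
qed

text \<open>This is Jensen's inequality for \<open>t \<mapsto> t\<^sup>r\<close> with equal weights. It is applied on the support \<open>T\<close> of
  \<open>a\<close>, where all values lie in the open half-line on which \<open>powr_convex\<close> holds; returning to \<open>S\<close>
  is harmless because \<open>card T powr (r - 1)\<close> only grows when \<open>T\<close> is enlarged.\<close>

lemma sum_powr_le_card_powr:
  fixes a :: "'a \<Rightarrow> real"
  assumes "finite S" and "r \<ge> 1" and nonneg: "\<And>i. i \<in> S \<Longrightarrow> a i \<ge> 0"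
  shows "(\<Sum>i\<in>S. a i) powr r \<le> real (card S) powr (r - 1) * (\<Sum>i\<in>S. a i powr r)"
proof -
  define T where "T = {i \<in> S. a i \<noteq> 0}"
  have T: "finite T" "T \<subseteq> S" using assms by (auto simp: T_def)
  have sT: "(\<Sum>i\<in>S. a i) = (\<Sum>i\<in>T. a i)" "(\<Sum>i\<in>S. a i powr r) = (\<Sum>i\<in>T. a i powr r)"
    using assms(1) by (auto simp: T_def intro!: sum.mono_neutral_right)
  show ?thesis
  proof (cases "T = {}")
    case True
    then show ?thesis using sT by simp
  next
    case False
    define n where "n = real (card T)"
    have n: "n > 0" using T False by (simp add: n_def card_gt_0_iff)
    have pos: "a i > 0" if "i \<in> T" for i
      using that nonneg[of i] by (auto simp: T_def)
    have "(\<Sum>i\<in>T. (1 / n) *\<^sub>R a i) powr r \<le> (\<Sum>i\<in>T. (1 / n) * (a i powr r))"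
      using T(1) False powr_convex[OF assms(2)] n pos
      by (intro convex_on_sum[where C = "{0<..}"]) (auto simp: n_def)
    then have "((\<Sum>i\<in>T. a i) / n) powr r \<le> (\<Sum>i\<in>T. a i powr r) / n"
      by (simp add: sum_divide_distrib)
    moreover have "((\<Sum>i\<in>T. a i) / n) powr r = (\<Sum>i\<in>T. a i) powr r / n powr r"
      by (rule powr_divide)
    ultimately have "(\<Sum>i\<in>T. a i) powr r \<le> n powr (r - 1) * (\<Sum>i\<in>T. a i powr r)"
      using n by (simp add: powr_diff field_simps)
    also have "\<dots> \<le> real (card S) powr (r - 1) * (\<Sum>i\<in>T. a i powr r)"
      using assms T n by (intro mult_right_mono powr_mono2 sum_nonneg) (auto simp: n_def card_mono)
    finally show ?thesis using sT by simp
  qed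
qed

text \<open>The factor \<open>2 * lp_const p q\<close> is the square of the best constant comparing the Euclidean norm
  with the \<open>\<ell>\<^sub>p\<close> norm on \<open>q\<close>-dimensional space.\<close>

lemma norm_sq_le_lp_norm_sq:
  fixes x :: "real ^ 'n"
  assumes "p > 1"
  shows "(norm x)\<^sup>2 \<le> 2 * lp_const p CARD('n) * (lp_norm p x)\<^sup>2"
proof -
  define S where "S = (\<Sum>i\<in>UNIV. \<bar>x $ i\<bar> powr p)"
  have S0: "S \<ge> 0" by (simp add: S_def sum_nonneg)
  have nrm: "(norm x)\<^sup>2 = (\<Sum>i\<in>UNIV. (x $ i)\<^sup>2)"
    unfolding power2_norm_eq_inner inner_vec_def by (simp add: power2_eq_square)
  have lp: "(lp_norm p x)\<^sup>2 = S powr (2 / p)"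
    using S0 by (simp add: lp_norm_def S_def powr_powr power2_eq_square flip: powr_add)
  show ?thesis
  proof (cases "p \<ge> 2")
    case True
    define q where "q = real CARD('n)"
    have q: "q > 0" by (simp add: q_def)
    have sq: "((x $ i)\<^sup>2) powr (p / 2) = \<bar>x $ i\<bar> powr p" for i
    proof -
      have "(x $ i)\<^sup>2 = \<bar>x $ i\<bar> powr 2" by simp
      then show ?thesis by (simp add: powr_powr del: powr_numeral)
    qed
    have "(\<Sum>i\<in>UNIV. (x $ i)\<^sup>2) powr (p / 2) \<le> q powr (p / 2 - 1) * S"
      using sum_powr_le_card_powr[of UNIV "p / 2" "\<lambda>i. (x $ i)\<^sup>2"] True
      by (simp add: sq S_def q_def)
    then have "((\<Sum>i\<in>UNIV. (x $ i)\<^sup>2) powr (p / 2)) powr (2 / p) \<le> (q powr (p / 2 - 1) * S) powr (2 / p)"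
      using assms by (intro powr_mono2) auto
    also have "((\<Sum>i\<in>UNIV. (x $ i)\<^sup>2) powr (p / 2)) powr (2 / p) = (\<Sum>i\<in>UNIV. (x $ i)\<^sup>2)"
      using assms by (simp add: powr_powr sum_nonneg)
    also have "(q powr (p / 2 - 1) * S) powr (2 / p) = q powr ((p / 2 - 1) * (2 / p)) * S powr (2 / p)"
      using q S0 by (simp add: powr_mult powr_powr)
    also have "(p / 2 - 1) * (2 / p) = 1 - 2 / p" using assms by (simp add: field_simps)
    finally show ?thesis using True by (simp add: nrm lp lp_const_def q_def)
  next
    case False
    \<comment> \<open>Each \<open>\<bar>x $ i\<bar>\<close> is at most \<open>S powr (1 / p)\<close>; spend \<open>2 - p\<close> of the two powers on that bound and
        sum the remaining \<open>p\<close>.\<close>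
    have "(x $ i)\<^sup>2 \<le> \<bar>x $ i\<bar> powr p * S powr ((2 - p) / p)" for i
    proof -
      have "\<bar>x $ i\<bar> powr p \<le> S" unfolding S_def by (rule member_le_sum) auto
      then have "(\<bar>x $ i\<bar> powr p) powr ((2 - p) / p) \<le> S powr ((2 - p) / p)"
        using False assms by (intro powr_mono2) auto
      then have "\<bar>x $ i\<bar> powr (2 - p) \<le> S powr ((2 - p) / p)"
        using assms by (simp add: powr_powr)
      then have "\<bar>x $ i\<bar> powr p * \<bar>x $ i\<bar> powr (2 - p) \<le> \<bar>x $ i\<bar> powr p * S powr ((2 - p) / p)"
        by (rule mult_left_mono) simp
      moreover have "\<bar>x $ i\<bar> powr p * \<bar>x $ i\<bar> powr (2 - p) = (x $ i)\<^sup>2"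
        by (simp flip: powr_add)
      ultimately show ?thesis by simp
    qed
    then have "(\<Sum>i\<in>UNIV. (x $ i)\<^sup>2) \<le> S * S powr ((2 - p) / p)"
      unfolding S_def sum_distrib_right by (intro sum_mono)
    also have "S * S powr ((2 - p) / p) = S powr (1 + (2 - p) / p)"
      using S0 by (cases "S = 0") (simp_all add: powr_add)
    also have "1 + (2 - p) / p = 2 / p" using assms by (simp add: field_simps)
    finally show ?thesis using False by (simp add: nrm lp lp_const_def)
  qed
qed

text \<open>In the expanded square the cross term splits into the two hyperplane distances
  \<open>w' \<bullet> (y - y')\<close> and \<open>w \<bullet> (y' - y)\<close>; the first is the one to be bounded, and the second, like the
  two squares, is nonnegative and can be dropped.\<close>

lemma hyperplane_distance_le_norm_sq:
  fixes y y' w w' :: "'a :: real_inner"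
  assumes "\<eta> > 0" and "w \<bullet> (y' - y) \<ge> 0"
  shows "2 * \<eta> * (w' \<bullet> (y - y')) \<le> (norm ((y - \<eta> *\<^sub>R w) - (y' - \<eta> *\<^sub>R w')))\<^sup>2"
proof -
  have "(norm ((y - \<eta> *\<^sub>R w) - (y' - \<eta> *\<^sub>R w')))\<^sup>2 = (norm ((y - y') - \<eta> *\<^sub>R (w - w')))\<^sup>2"
    by (simp add: algebra_simps)
  also have "\<dots> = (norm (y - y'))\<^sup>2 + (norm (\<eta> *\<^sub>R (w - w')))\<^sup>2
      + 2 * \<eta> * (w' \<bullet> (y - y')) + 2 * \<eta> * (w \<bullet> (y' - y))"
    unfolding power2_norm_eq_inner by (simp add: algebra_simps inner_commute)
  finally show ?thesis using assms by simp
qed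

theorem lemma7:
  fixes p \<eta> :: real
    and A :: "(real ^ 'n) set"
    and P :: "nat \<Rightarrow> (real ^ 'n) set"
    and k :: nat
    and v v' y y' z z' w w' \<alpha> \<alpha>' :: "real ^ 'n"
  assumes "1 < p" and "\<eta> > 0"
    and "compact A" and "convex A" and "interior A \<noteq> {}"
    and "norm_min_run p A P k"
    and "v extreme_point_of P k" and "v \<notin> A"
    and "v' extreme_point_of P k" and "v' \<notin> A"
    and "lp_nearest p A v y" and "lp_nearest p A v' y'"
    and "z = y - v" and "z' = y' - v'"
    and "w = lp_grad p z" and "w' = lp_grad p z'"
    and "\<alpha> = y - \<eta> *\<^sub>R w" and "\<alpha>' = y' - \<eta> *\<^sub>R w'"
  shows "y \<in> frontier A \<and> y' \<in> frontier A
    \<and> lp_norm (p / (p - 1)) w = 1 \<and> lp_norm (p / (p - 1)) w' = 1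
    \<and> w' \<bullet> (y - y') \<ge> 0
    \<and> w' \<bullet> (y - y') \<le> lp_const p CARD('n) * ((lp_norm p (\<alpha> - \<alpha>'))\<^sup>2 / \<eta>)"
proof -
  have "y \<in> A" "y' \<in> A"
    using assms(11,12) by (auto simp: lp_nearest_def is_arg_min_linorder)
  then have "z \<noteq> 0" "z' \<noteq> 0" using \<open>v \<notin> A\<close> \<open>v' \<notin> A\<close> assms(13,14) by auto
  then have dual: "lp_norm (p / (p - 1)) w = 1" "lp_norm (p / (p - 1)) w' = 1"
    using \<open>1 < p\<close> assms(15,16) by (auto intro: lp_norm_lp_grad)
  have front: "y \<in> frontier A" "y' \<in> frontier A"
    using lp_nearest_in_frontier \<open>1 < p\<close> \<open>v \<notin> A\<close> \<open>v' \<notin> A\<close> assms(11,12) by blast+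
  have "w \<bullet> (y' - y) \<ge> 0" and d: "w' \<bullet> (y - y') \<ge> 0"
    using lp_nearest_supporting[OF \<open>1 < p\<close> \<open>convex A\<close>] \<open>v \<notin> A\<close> \<open>v' \<notin> A\<close> \<open>y \<in> A\<close> \<open>y' \<in> A\<close> assms(11-16)
    by blast+
  then have "2 * \<eta> * (w' \<bullet> (y - y')) \<le> (norm (\<alpha> - \<alpha>'))\<^sup>2"
    unfolding assms(17,18) using \<open>\<eta> > 0\<close> by (intro hyperplane_distance_le_norm_sq)
  also have "\<dots> \<le> 2 * lp_const p CARD('n) * (lp_norm p (\<alpha> - \<alpha>'))\<^sup>2"
    using \<open>1 < p\<close> by (rule norm_sq_le_lp_norm_sq)
  finally have "w' \<bullet> (y - y') \<le> lp_const p CARD('n) * ((lp_norm p (\<alpha> - \<alpha>'))\<^sup>2 / \<eta>)"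
    using \<open>\<eta> > 0\<close> by (simp add: field_simps)
  with dual front d show ?thesis by blast
qed

end
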